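(* Let $K$ be a field and let $S\neq\mathbb{N}_0$ be a numerical monoid with Frobenius number $\mathsf{f}(S)=\max(\mathbb{N}_0\setminus S)$. Then the following two implications hold. (i) If for all $a_0,\ldots,a_{\mathsf{f}(S)}\in K$ with $a_0\neq 0$ there exists at least one irreducible polynomial in $K[X]$ whose coefficient at the monomial $X^i$ equals $a_i$ for all integers $i$ with $0\le i\le \mathsf{f}(S)$, then every class of $\mathcal{C}_v(K[S])$ contains at least one prime divisor of $K[S]$. (ii) If for all $a_0,\ldots,a_{\mathsf{f}(S)}\in K$ with $a_0\neq 0$ there exist infinitely many irreducible polynomials in $K[X]$ whose coefficient at the monomial $X^i$ equals $a_i$ for all integers $i$ with $0\le i\le \mathsf{f}(S)$, then every class of $\mathcal{C}_v(K[S])$ contains infinitely many prime divisors of $K[S]$.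
   Context: A numerical monoid is a submonoid $S$ of $(\mathbb{N}_0,+)$ such that $\mathbb{N}_0\setminus S$ is finite. $K[S]$ denotes the monoid algebra, i.e. the subring of $K[X]$ consisting of all polynomials whose monomials have exponents in $S$. For a domain $D$ with quotient field $F$ and $A\subseteq F$, put $A^{-1}=\{x\in F\mid xA\subseteq D\}$ and $A_v=(A^{-1})^{-1}$. A fractional $v$-ideal is a subset $I\subseteq F$ with $I=I_v$ and $cI\subseteq D$ for some nonzero $c\in D$; it is a $v$-ideal if moreover $I\subseteq D$. A fractional $v$-ideal $I$ is $v$-invertible if $(IJ)_v=D$ for some fractional $v$-ideal $J$. The $v$-invertible fractional $v$-ideals form a group under $I\cdot_v J=(IJ)_v$, and the class group ($v$-class group) $\mathcal{C}_v(D)$ is the factor group of this group by the subgroup of nonzero principal fractional ideals. A prime divisor of $D$ is a height-one prime ideal of $D$ that is a $v$-invertible $v$-ideal; it lies in (is contained in) its class in $\mathcal{C}_v(D)$. *)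

theory Defs
  imports
    "HOL-Algebra.Ideal"
    "HOL-Library.Set_Algebras"
    "HOL-Library.Extended_Nat"
    "HOL-Computational_Algebra.Polynomial_Factorial"
begin

text \<open>
  A domain is given as a subset \<open>D\<close> (closed under the ring operations and containing 1) of
  a field type; its quotient field is formed inside that type. The operations \<open>A * B\<close> and
  \<open>x *o A\<close> on sets are the elementwise ones of \<open>Set_Algebras\<close>.
\<close>

definition quot_field :: "'f::field set \<Rightarrow> 'f set" where
  "quot_field D = {x / y |x y. x \<in> D \<and> y \<in> D \<and> y \<noteq> 0}"

definition frac_inv :: "'f::field set \<Rightarrow> 'f set \<Rightarrow> 'f set" where
  "frac_inv D A = {x \<in> quot_field D. x *o A \<subseteq> D}"

definition v_closure :: "'f::field set \<Rightarrow> 'f set \<Rightarrow> 'f set" where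
  "v_closure D A = frac_inv D (frac_inv D A)"

definition fractional_v_ideal :: "'f::field set \<Rightarrow> 'f set \<Rightarrow> bool" where
  "fractional_v_ideal D I \<longleftrightarrow>
     I \<subseteq> quot_field D \<and> I = v_closure D I \<and> (\<exists>c\<in>D. c \<noteq> 0 \<and> c *o I \<subseteq> D)"

definition v_ideal :: "'f::field set \<Rightarrow> 'f set \<Rightarrow> bool" where
  "v_ideal D I \<longleftrightarrow> fractional_v_ideal D I \<and> I \<subseteq> D"

text \<open>
  \<open>I * J\<close> is the set of products, not the additive group generated by them. Since
  \<open>frac_inv D A\<close> depends only on the additive group generated by \<open>A\<close>, both readings of
  the product have the same \<open>v\<close>-closure.
\<close>

definition v_mult :: "'f::field set \<Rightarrow> 'f set \<Rightarrow> 'f set \<Rightarrow> 'f set" where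
  "v_mult D I J = v_closure D (I * J)"

definition v_invertible :: "'f::field set \<Rightarrow> 'f set \<Rightarrow> bool" where
  "v_invertible D I \<longleftrightarrow>
     fractional_v_ideal D I \<and> (\<exists>J. fractional_v_ideal D J \<and> v_mult D I J = D)"

definition v_invertible_group :: "'f::field set \<Rightarrow> 'f set monoid" where
  "v_invertible_group D = \<lparr>carrier = {I. v_invertible D I}, monoid.mult = v_mult D, one = D\<rparr>"

definition principal_fractional_ideals :: "'f::field set \<Rightarrow> 'f set set" where
  "principal_fractional_ideals D = {x *o D |x. x \<in> quot_field D \<and> x \<noteq> 0}"

text \<open>
  The elements of the class group are cosets, hence sets of \<open>v\<close>-invertible fractional
  \<open>v\<close>-ideals, so that an ideal \<open>P\<close> lies in the class \<open>C\<close> if and only if \<open>P \<in> C\<close>.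
\<close>

definition v_class_group :: "'f::field set \<Rightarrow> 'f set set monoid" where
  "v_class_group D = v_invertible_group D Mod principal_fractional_ideals D"

definition domain_ring :: "'f::field set \<Rightarrow> 'f ring" where
  "domain_ring D = \<lparr>carrier = D, monoid.mult = (*), one = 1, zero = 0, add = (+)\<rparr>"

text \<open>The height of a prime ideal \<open>P\<close>: the supremum of the lengths \<open>n\<close> of chains
  \<open>Q 0 \<subset> \<dots> \<subset> Q n = P\<close> of prime ideals.\<close>

definition prime_height :: "('a, 'b) ring_scheme \<Rightarrow> 'a set \<Rightarrow> enat" where
  "prime_height R P =
     Sup {enat n |n. \<exists>Q::nat \<Rightarrow> 'a set.
       (\<forall>i\<le>n. primeideal (Q i) R) \<and> (\<forall>i<n. Q i \<subset> Q (Suc i)) \<and> Q n = P}"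

definition prime_divisor :: "'f::field set \<Rightarrow> 'f set \<Rightarrow> bool" where
  "prime_divisor D P \<longleftrightarrow>
     primeideal P (domain_ring D) \<and> prime_height (domain_ring D) P = 1 \<and>
     v_ideal D P \<and> v_invertible D P"

definition numerical_monoid :: "nat set \<Rightarrow> bool" where
  "numerical_monoid S \<longleftrightarrow> 0 \<in> S \<and> (\<forall>a\<in>S. \<forall>b\<in>S. a + b \<in> S) \<and> finite (- S)"

definition frobenius_number :: "nat set \<Rightarrow> nat" where
  "frobenius_number S = Max (- S)"

text \<open>The monoid algebra \<open>K[S] \<subseteq> K[X]\<close>, embedded into the field of rational functions.\<close>

definition monoid_algebra :: "nat set \<Rightarrow> 'k::field poly fract set" where
  "monoid_algebra S = to_fract ` {p. \<forall>n. coeff p n \<noteq> 0 \<longrightarrow> n \<in> S}"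

end

theory Submission
  imports Defs
begin

text \<open>
  Let \<open>D = K[S]\<close> and let \<open>f\<close> be the Frobenius number, so that \<open>X\<^sup>f\<^sup>+\<^sup>1 K[X] \<subseteq> D\<close>. Away from the
  maximal ideal \<open>M\<close> of the polynomials without constant term, \<open>D\<close> looks like \<open>K[X]\<close>, where all
  ideals are principal. At \<open>M\<close>, a \<open>v\<close>-invertible ideal is principal as well and can be scaled
  to contain an element with nonzero constant term. Together this shows that every
  \<open>v\<close>-invertible ideal is, up to a factor from the quotient field, a contraction
  \<open>g K[X] \<inter> D\<close> with \<open>g(0) \<noteq> 0\<close> (lemma \<open>v_invertible_multiple_contraction\<close>). The proof is
  direct and avoids localizations: if \<open>(I J)\<^sub>v = D\<close>, then \<open>I J\<close> contains some \<open>a b\<close> with nonzero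
  constant term, since otherwise \<open>X\<^sup>f\<close> would be in the inverse \<open>D\<close> of \<open>I J\<close>; and \<open>b\<close> is the factor.

  The point of the normal form is that its class depends only on \<open>g\<close> modulo \<open>X\<^sup>f\<^sup>+\<^sup>1\<close>: if \<open>p\<close> has the
  same coefficients as \<open>g\<close> up to \<open>X\<^sup>f\<close>, then \<open>p t \<in> D\<close> if and only if \<open>g t \<in> D\<close>, because \<open>D\<close>
  contains \<open>(p - g) t\<close>. So multiplication by \<open>p / g\<close> maps the contraction of \<open>(g)\<close> onto that of
  \<open>(p)\<close> (lemma \<open>contraction_scale\<close>). The hypothesis of the theorem supplies an irreducible such
  \<open>p\<close>, and for irreducible \<open>p\<close> with \<open>p(0) \<noteq> 0\<close> the contraction of \<open>(p)\<close> is a prime ideal of height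
  one (lemmas \<open>primeideal_contraction\<close>, \<open>prime_height_contraction\<close>); it inherits
  \<open>v\<close>-invertibility from the ideal that it is a multiple of. Different \<open>p\<close> with the same constant
  term have different contractions (lemma \<open>contraction_inject\<close>), which gives the statement about
  infinitely many prime divisors.
\<close>

section \<open>Fractional ideals of a domain and their multiples\<close>

text \<open>
  The working setting: a subring of a field whose fractions exhaust the field, so that
  \<^term>\<open>frac_inv D A\<close> ranges over the whole field and multiplication by a nonzero field
  element is a bijection that commutes with everything in sight.
\<close>

locale fraction_domain =
  fixes D :: "'f::field set"
  assumes one_mem: "1 \<in> D"
    and diff_mem: "x \<in> D \<Longrightarrow> y \<in> D \<Longrightarrow> x - y \<in> D"
    and mult_mem: "x \<in> D \<Longrightarrow> y \<in> D \<Longrightarrow> x * y \<in> D"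
    and quot_field_eq: "quot_field D = UNIV"
begin

lemma zero_mem: "0 \<in> D"
  using diff_mem[OF one_mem one_mem] by simp

lemma uminus_mem: "x \<in> D \<Longrightarrow> - x \<in> D"
  using diff_mem[OF zero_mem] by simp

lemma add_mem: "x \<in> D \<Longrightarrow> y \<in> D \<Longrightarrow> x + y \<in> D"
  using diff_mem[of x "- y"] uminus_mem by simp

lemma mem_scale_iff: "x \<noteq> 0 \<Longrightarrow> y \<in> x *o A \<longleftrightarrow> y / x \<in> (A :: 'f set)"
  by (auto simp: elt_set_times_def intro: bexI[of _ "y / x"])

lemma frac_inv_iff: "x \<in> frac_inv D A \<longleftrightarrow> (\<forall>a\<in>A. x * a \<in> D)"
  by (auto simp: frac_inv_def quot_field_eq elt_set_times_def)

lemma frac_inv_scale: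
  assumes "x \<noteq> 0"
  shows "frac_inv D (x *o A) = inverse x *o frac_inv D A"
proof (rule Set.set_eqI)
  fix y
  have "y \<in> frac_inv D (x *o A) \<longleftrightarrow> (\<forall>a\<in>A. y * (x * a) \<in> D)"
    by (auto simp: frac_inv_iff elt_set_times_def)
  also have "\<dots> \<longleftrightarrow> y * x \<in> frac_inv D A" by (simp add: frac_inv_iff mult.assoc)
  also have "\<dots> \<longleftrightarrow> y \<in> inverse x *o frac_inv D A"
    using assms by (simp add: mem_scale_iff divide_inverse)
  finally show "y \<in> frac_inv D (x *o A) \<longleftrightarrow> y \<in> inverse x *o frac_inv D A" .
qed

lemma v_closure_scale: "x \<noteq> 0 \<Longrightarrow> v_closure D (x *o A) = x *o v_closure D A"
  by (simp add: v_closure_def frac_inv_scale)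

lemma subset_v_closure: "A \<subseteq> v_closure D A"
proof
  fix a assume "a \<in> A"
  then have "a * y \<in> D" if "y \<in> frac_inv D A" for y
    using that by (simp add: frac_inv_iff mult.commute[of a])
  then show "a \<in> v_closure D A" by (simp add: v_closure_def frac_inv_iff[of a])
qed

lemma frac_inv_times_domain: "frac_inv D (D * A) = frac_inv D A"
proof (intro Set.set_eqI iffI)
  fix x assume x: "x \<in> frac_inv D (D * A)"
  show "x \<in> frac_inv D A"
    unfolding frac_inv_iff
  proof
    fix a assume "a \<in> A"
    with one_mem have "1 * a \<in> D * A" by blast
    with x show "x * a \<in> D" by (simp add: frac_inv_iff)
  qed
next
  fix x assume x: "x \<in> frac_inv D A"
  have "x * (d * a) \<in> D" if "d \<in> D" "a \<in> A" for d a
    using x that mult_mem[of d "x * a"] by (simp add: frac_inv_iff mult.left_commute)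
  then show "x \<in> frac_inv D (D * A)" by (auto simp: frac_inv_iff set_times_def)
qed

lemma scale_times: "(x *o A) * B = x *o (A * B)" for A B :: "'f set"
  by (auto simp: elt_set_times_def set_times_def mult.assoc; metis mult.assoc)

lemma v_mult_principal:
  assumes "x \<noteq> 0"
  shows "v_mult D (x *o D) A = x *o v_closure D A"
  using assms by (simp add: v_mult_def scale_times v_closure_scale)
    (simp add: v_closure_def frac_inv_times_domain)

lemma fractional_v_ideal_scale:
  assumes x: "x \<noteq> 0" and I: "fractional_v_ideal D I"
  shows "fractional_v_ideal D (x *o I)"
proof -
  from I obtain c where c: "c \<in> D" "c \<noteq> 0" "c *o I \<subseteq> D" and cl: "v_closure D I = I"
    by (auto simp: fractional_v_ideal_def)
  have "x \<in> quot_field D" by (simp add: quot_field_eq)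
  then obtain a b where ab: "x = a / b" "a \<in> D" "b \<in> D" "b \<noteq> 0"
    by (auto simp: quot_field_def)
  have "(b * c) * (x * i) \<in> D" if "i \<in> I" for i
  proof -
    have "c * i \<in> D" using that c by (auto simp: elt_set_times_def)
    then have "a * (c * i) \<in> D" using ab mult_mem by blast
    then show ?thesis using ab by (simp add: ac_simps)
  qed
  then have "(b * c) *o (x *o I) \<subseteq> D" by (auto simp: elt_set_times_def)
  moreover have "b * c \<in> D" "b * c \<noteq> 0" using ab c mult_mem by auto
  ultimately have "\<exists>c\<in>D. c \<noteq> 0 \<and> c *o (x *o I) \<subseteq> D" by blast
  then show ?thesis
    using cl x by (simp add: fractional_v_ideal_def quot_field_eq v_closure_scale)
qed

lemma v_invertible_scale:
  assumes x: "x \<noteq> 0" and I: "v_invertible D I"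
  shows "v_invertible D (x *o I)"
proof -
  from I obtain J where J: "fractional_v_ideal D J" "v_mult D I J = D"
    and fI: "fractional_v_ideal D I"
    by (auto simp: v_invertible_def)
  have "(x *o I) * (inverse x *o J) = I * J"
  proof -
    have "(x *o I) * (inverse x *o J) = x *o (inverse x *o (J * I))"
      by (metis scale_times mult.commute)
    also have "\<dots> = I * J" using x
      by (simp add: set_times_rearrange2 mult.commute flip: set_times_elim)
    finally show ?thesis .
  qed
  then have "v_mult D (x *o I) (inverse x *o J) = D" using J by (simp add: v_mult_def)
  then show ?thesis
    unfolding v_invertible_def
    using fractional_v_ideal_scale[OF x fI] fractional_v_ideal_scale[of "inverse x" J] J x by auto
qed

text \<open>
  The cosets of the class group consist of the products \<^term>\<open>v_mult D (x *o D) I\<close>; as \<open>I\<close> is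
  \<open>v\<close>-closed, these are just the multiples of \<open>I\<close>.
\<close>

lemma v_class_eq_multiples:
  assumes "C \<in> carrier (v_class_group D)"
  obtains I where "v_invertible D I" and "C = {x *o I |x. x \<noteq> 0}"
proof -
  from assms obtain I where I: "v_invertible D I"
    and C: "C = (\<Union>h\<in>principal_fractional_ideals D. {v_mult D h I})"
    by (auto simp: v_class_group_def FactGroup_def RCOSETS_def r_coset_def v_invertible_group_def)
  have "v_closure D I = I" using I by (auto simp: v_invertible_def fractional_v_ideal_def)
  then have "C = {x *o I |x. x \<noteq> 0}"
    unfolding C principal_fractional_ideals_def quot_field_eq
    by (auto simp: v_mult_principal; metis v_mult_principal)
  with I show ?thesis using that by blast
qed

lemma cring_domain_ring: "cring (domain_ring D)"
proof (rule cringI)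
  show "abelian_group (domain_ring D)"
    by (rule abelian_groupI)
      (auto simp: domain_ring_def zero_mem add_mem ac_simps intro: bexI[of _ "- x" for x] uminus_mem)
  show "comm_monoid (domain_ring D)"
    by (rule comm_monoidI) (auto simp: domain_ring_def one_mem mult_mem ac_simps)
qed (auto simp: domain_ring_def algebra_simps)

lemma primeideal_domain_ringI:
  assumes "P \<subseteq> D" "0 \<in> P" "1 \<notin> P"
    and diff: "\<And>x y. x \<in> P \<Longrightarrow> y \<in> P \<Longrightarrow> x - y \<in> P"
    and mult: "\<And>x y. x \<in> D \<Longrightarrow> y \<in> P \<Longrightarrow> x * y \<in> P"
    and prime: "\<And>x y. x \<in> D \<Longrightarrow> y \<in> D \<Longrightarrow> x * y \<in> P \<Longrightarrow> x \<in> P \<or> y \<in> P"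
  shows "primeideal P (domain_ring D)"
proof (rule primeidealI)
  interpret cring "domain_ring D" by (rule cring_domain_ring)
  have a_inv: "\<ominus>\<^bsub>domain_ring D\<^esub> x = - x" if "x \<in> D" for x
    using that by (intro minus_equality) (auto simp: domain_ring_def uminus_mem)
  have neg: "- x \<in> P" if "x \<in> P" for x using diff[OF \<open>0 \<in> P\<close> that] by simp
  have add: "x + y \<in> P" if "x \<in> P" "y \<in> P" for x y using diff[OF that(1) neg[OF that(2)]] by simp
  have "subgroup P (add_monoid (domain_ring D))"
  proof (rule add.subgroupI)
    fix x assume "x \<in> P"
    then show "\<ominus>\<^bsub>domain_ring D\<^esub> x \<in> P" using a_inv neg assms(1) by auto
  qed (use assms add in \<open>auto simp: domain_ring_def\<close>)
  then show "ideal P (domain_ring D)"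
    by (rule idealI[OF ring_axioms])
      (use mult in \<open>simp_all add: domain_ring_def\<close>, metis mult.commute)
  show "carrier (domain_ring D) \<noteq> P" using one_mem assms(3) by (auto simp: domain_ring_def)
qed (use cring_domain_ring prime in \<open>auto simp: domain_ring_def\<close>)

lemma primeideal_domain_ringD:
  assumes "primeideal P (domain_ring D)"
  shows "P \<subseteq> D" "0 \<in> P"
    and "x \<in> D \<Longrightarrow> y \<in> P \<Longrightarrow> x * y \<in> P"
    and "x \<in> D \<Longrightarrow> y \<in> D \<Longrightarrow> x * y \<in> P \<Longrightarrow> x \<in> P \<or> y \<in> P"
proof -
  interpret primeideal P "domain_ring D" by fact
  show sub: "P \<subseteq> D" using a_subset by (simp add: domain_ring_def)
  show "0 \<in> P" using additive_subgroup.zero_closed[OF additive_subgroup_axioms]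
    by (simp add: domain_ring_def)
  show "x \<in> D \<Longrightarrow> y \<in> P \<Longrightarrow> x * y \<in> P" using I_l_closed[of y x] by (simp add: domain_ring_def)
  show "x \<in> D \<Longrightarrow> y \<in> D \<Longrightarrow> x * y \<in> P \<Longrightarrow> x \<in> P \<or> y \<in> P"
    using I_prime[of x y] by (simp add: domain_ring_def)
qed

lemma prime_height_eq_1:
  assumes P: "primeideal P (domain_ring D)" and "P \<noteq> {0}"
    and minimal: "\<And>Q. primeideal Q (domain_ring D) \<Longrightarrow> Q \<subseteq> P \<Longrightarrow> Q \<noteq> {0} \<Longrightarrow> Q = P"
  shows "prime_height (domain_ring D) P = 1"
  unfolding prime_height_def
proof (rule antisym)
  have zero: "primeideal {0} (domain_ring D)"
    by (rule primeideal_domain_ringI) (auto simp: zero_mem)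
  have "{0} \<subset> P" using primeideal_domain_ringD(2)[OF P] assms(2) by auto
  then have "\<exists>Q. (\<forall>i\<le>1. primeideal (Q i) (domain_ring D)) \<and> (\<forall>i<1. Q i \<subset> Q (Suc i)) \<and> Q 1 = P"
    using P zero by (intro exI[of _ "\<lambda>i::nat. if i = 0 then {0} else P"]) auto
  then show "1 \<le> Sup {enat n |n. \<exists>Q. (\<forall>i\<le>n. primeideal (Q i) (domain_ring D)) \<and>
      (\<forall>i<n. Q i \<subset> Q (Suc i)) \<and> Q n = P}"
    by (intro Sup_upper) (auto simp: one_enat_def)
  show "Sup {enat n |n. \<exists>Q. (\<forall>i\<le>n. primeideal (Q i) (domain_ring D)) \<and>
      (\<forall>i<n. Q i \<subset> Q (Suc i)) \<and> Q n = P} \<le> 1"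
  proof (rule Sup_least, clarify)
    fix n and Q :: "nat \<Rightarrow> 'f set"
    assume prime: "\<forall>i\<le>n. primeideal (Q i) (domain_ring D)"
      and chain: "\<forall>i<n. Q i \<subset> Q (Suc i)" and "P = Q n"
    show "enat n \<le> 1"
    proof (rule ccontr)
      assume "\<not> enat n \<le> 1"
      then have "1 < n" by (simp add: one_enat_def)
      then obtain m where n: "n = Suc (Suc m)" using less_imp_Suc_add[of 1 n] by auto
      have "Q m \<subset> Q (Suc m)" "Q (Suc m) \<subset> P" using chain n \<open>P = Q n\<close> by auto
      then have "Q (Suc m) = {0}" using minimal[of "Q (Suc m)"] prime n by auto
      moreover have "0 \<in> Q m" using primeideal_domain_ringD(2) prime n by auto
      ultimately show False using \<open>Q m \<subset> Q (Suc m)\<close> by auto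
    qed
  qed
qed

end

section \<open>Ideals and divisibility of polynomials over a field\<close>

lemma poly_ideal_generator:
  fixes N :: "'k::field poly set"
  assumes "u \<in> N" "u \<noteq> 0"
    and diff: "\<And>p q. p \<in> N \<Longrightarrow> q \<in> N \<Longrightarrow> p - q \<in> N"
    and mult: "\<And>r p. p \<in> N \<Longrightarrow> r * p \<in> N"
  obtains g where "g \<in> N" "\<And>p. p \<in> N \<Longrightarrow> g dvd p"
proof -
  obtain g where g: "g \<in> N \<and> g \<noteq> 0"
    and least: "\<And>p. p \<in> N \<and> p \<noteq> 0 \<Longrightarrow> degree g \<le> degree p"
    using arg_min_natI[of "\<lambda>p. p \<in> N \<and> p \<noteq> 0" u degree]
      arg_min_nat_le[of "\<lambda>p. p \<in> N \<and> p \<noteq> 0" _ degree] assms(1,2)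
    by blast
  have "g dvd p" if p: "p \<in> N" for p
  proof (rule ccontr)
    assume "\<not> g dvd p"
    then have "p mod g \<noteq> 0" by (simp add: dvd_eq_mod_eq_0)
    moreover have "p mod g \<in> N" using diff[OF p mult[of g "p div g"]] g
      by (simp add: minus_div_mult_eq_mod)
    ultimately show False using least[of "p mod g"] degree_mod_less'[of g p] g by fastforce
  qed
  with g that show ?thesis by blast
qed

lemma irreducible_not_dvd_monom:
  fixes p :: "'k::field poly"
  assumes p: "irreducible p" "coeff p 0 \<noteq> 0"
  shows "\<not> p dvd monom 1 n"
proof (induction n)
  case 0
  then show ?case using p(1) irreducible_not_unit by (auto simp flip: one_pCons simp: monom_0)
next
  case (Suc n)
  show ?case
  proof
    assume "p dvd monom 1 (Suc n)"
    then obtain r where r: "monom 1 (Suc n) = p * r" by (auto simp: dvd_def)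
    have "coeff p 0 * coeff r 0 = coeff (monom 1 (Suc n)) 0" unfolding r by (simp add: coeff_mult)
    then have "coeff r 0 = 0" using p(2) by simp
    then obtain r' where "r = pCons 0 r'" by (metis coeff_pCons_0 pCons_cases)
    then have "monom 1 n = p * r'" using r by (simp add: monom_Suc)
    with Suc show False by auto
  qed
qed

lemma irreducible_dvd_monom_multiple:
  fixes p t :: "'k::field poly"
  assumes p: "irreducible p" "coeff p 0 \<noteq> 0" and dvd: "p dvd monom 1 n * t"
  shows "p dvd t"
  using field_poly_irreducible_imp_prime[OF p(1)] irreducible_not_dvd_monom[OF p] dvd
    prime_elem_dvd_mult_iff by blast

section \<open>Polynomials with exponents in a numerical monoid\<close>

definition exponents_in :: "nat set \<Rightarrow> 'k::zero poly \<Rightarrow> bool" where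
  "exponents_in S p \<longleftrightarrow> (\<forall>n. coeff p n \<noteq> 0 \<longrightarrow> n \<in> S)"

lemma to_fract_mem_monoid_algebra_iff:
  "to_fract p \<in> monoid_algebra S \<longleftrightarrow> exponents_in S p"
  by (auto simp: monoid_algebra_def exponents_in_def)

lemma monoid_algebraE:
  assumes "x \<in> monoid_algebra S"
  obtains p where "x = to_fract p" "exponents_in S p"
  using assms by (auto simp: monoid_algebra_def exponents_in_def)

lemma fract_eq_quotient:
  obtains a b where "x = to_fract a / to_fract b" "b \<noteq> 0"
  by (cases x) (auto simp: Fract_conv_to_fract)

text \<open>
  The contraction of the ideal \<open>(g)\<close> of the polynomial ring to the monoid algebra. Every
  \<open>v\<close>-invertible ideal is a multiple of such a contraction, and the contractions for irreducible
  \<open>g\<close> are the candidates for prime divisors.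
\<close>

definition contraction :: "nat set \<Rightarrow> 'k::field poly \<Rightarrow> 'k poly fract set" where
  "contraction S g = to_fract ` {p. g dvd p \<and> exponents_in S p}"

lemma to_fract_mem_contraction_iff:
  "to_fract p \<in> contraction S g \<longleftrightarrow> g dvd p \<and> exponents_in S p"
  by (auto simp: contraction_def)

lemma contraction_subset: "contraction S g \<subseteq> monoid_algebra S"
  by (auto simp: contraction_def to_fract_mem_monoid_algebra_iff)

locale proper_numerical_monoid =
  fixes S :: "nat set"
  assumes numerical: "numerical_monoid S" and proper: "S \<noteq> UNIV"
begin

abbreviation "f \<equiv> frobenius_number S"

lemma zero_in: "0 \<in> S" and add_in: "a \<in> S \<Longrightarrow> b \<in> S \<Longrightarrow> a + b \<in> S"
  using numerical by (auto simp: numerical_monoid_def)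

lemma frobenius_notin: "f \<notin> S"
proof -
  have "finite (- S)" "- S \<noteq> {}" using numerical proper by (auto simp: numerical_monoid_def)
  then have "f \<in> - S" unfolding frobenius_number_def by (rule Max_in)
  then show ?thesis by simp
qed

lemma above_frobenius: "f < n \<Longrightarrow> n \<in> S"
proof (rule ccontr)
  assume "f < n" "n \<notin> S"
  moreover have "finite (- S)" using numerical by (auto simp: numerical_monoid_def)
  ultimately have "n \<le> f" unfolding frobenius_number_def by (intro Max_ge) auto
  with \<open>f < n\<close> show False by simp
qed

lemma exponents_in_diff:
  "exponents_in S p \<Longrightarrow> exponents_in S q \<Longrightarrow> exponents_in S (p - q)" for p q :: "'k::field poly"
  unfolding exponents_in_def by (metis coeff_diff diff_self)

lemma exponents_in_mult:
  fixes p q :: "'k::field poly"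
  assumes "exponents_in S p" "exponents_in S q"
  shows "exponents_in S (p * q)"
  unfolding exponents_in_def
proof (intro allI impI)
  fix n assume "coeff (p * q) n \<noteq> 0"
  then obtain i where "i \<le> n" "coeff p i * coeff q (n - i) \<noteq> 0"
    by (metis (no_types, lifting) atMost_iff coeff_mult sum.neutral)
  then show "n \<in> S" using add_in[of i "n - i"] assms by (auto simp: exponents_in_def)
qed

text \<open>The conductor of the monoid algebra in the polynomial ring contains \<open>X\<^sup>f\<^sup>+\<^sup>1\<close>.\<close>

lemma exponents_in_conductor: "exponents_in S (monom 1 (Suc f) * p)" for p :: "'k::field poly"
proof -
  have "n \<in> S" if "coeff (monom 1 (Suc f) * p) n \<noteq> 0" for n
    using that above_frobenius[of n] by (cases "n \<le> f") (auto simp: coeff_monom_mult)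
  then show ?thesis by (auto simp: exponents_in_def)
qed

lemma fraction_domain_monoid_algebra:
  "fraction_domain (monoid_algebra S :: 'k::field poly fract set)"
proof
  show "1 \<in> (monoid_algebra S :: 'k poly fract set)"
    using to_fract_mem_monoid_algebra_iff[of 1 S] zero_in by (simp add: exponents_in_def)
  show "quot_field (monoid_algebra S :: 'k poly fract set) = UNIV"
  proof -
    have "x \<in> quot_field (monoid_algebra S)" for x :: "'k poly fract"
    proof -
      obtain a b where ab: "x = to_fract a / to_fract b" "b \<noteq> 0" by (rule fract_eq_quotient)
      let ?e = "monom 1 (Suc f) :: 'k poly"
      have "x = to_fract (?e * a) / to_fract (?e * b)" using ab by (simp add: monom_eq_0_iff)
      moreover have "to_fract (?e * b) \<noteq> 0" using ab by (simp add: monom_eq_0_iff)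
      ultimately show ?thesis unfolding quot_field_def
        using exponents_in_conductor to_fract_mem_monoid_algebra_iff by blast
    qed
    then show ?thesis by blast
  qed
qed (auto elim!: monoid_algebraE simp: to_fract_mem_monoid_algebra_iff exponents_in_diff
      exponents_in_mult simp flip: to_fract_diff to_fract_mult)

text \<open>
  Having a nonzero constant term, \<open>u\<close> is invertible in the ring of power series with exponents
  in \<open>S\<close>. In coefficients: the lowest exponent of \<open>w\<close> outside \<open>S\<close> would survive in \<open>w * u\<close>.
\<close>

lemma exponents_in_cancel:
  fixes u w :: "'k::field poly"
  assumes u: "exponents_in S u" "coeff u 0 \<noteq> 0" and wu: "exponents_in S (w * u)"
  shows "exponents_in S w"
proof -
  have "n \<in> S" if "coeff w n \<noteq> 0" for n
    using that
  proof (induction n rule: less_induct)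
    case (less n)
    show ?case
    proof (rule ccontr)
      assume n: "n \<notin> S"
      have "coeff w i * coeff u (n - i) = 0" if "i < n" for i
        using less.IH[OF that] add_in[of i "n - i"] that n u(1) by (auto simp: exponents_in_def)
      then have "(\<Sum>i<n. coeff w i * coeff u (n - i)) = 0" by (intro sum.neutral) blast
      then have "coeff (w * u) n = coeff w n * coeff u 0"
        by (simp add: coeff_mult flip: lessThan_Suc_atMost)
      with less.prems u(2) have "coeff (w * u) n \<noteq> 0" by simp
      with wu n show False by (simp add: exponents_in_def)
    qed
  qed
  then show ?thesis by (simp add: exponents_in_def)
qed

section \<open>Every \<open>v\<close>-invertible ideal is a multiple of a contraction\<close>

text \<open>
  Let \<open>M\<close> be the maximal ideal of the polynomials without constant term. As \<open>X\<^sup>f * M\<close> has only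
  exponents above \<open>f\<close>, the inverse of \<open>M\<close> contains \<open>X\<^sup>f\<close>, which is outside the monoid algebra. So
  no subset of \<open>M\<close> has the whole monoid algebra as its \<open>v\<close>-closure.
\<close>

lemma v_closure_eq_imp_nonzero_constant_term:
  fixes A :: "'k::field poly fract set"
  assumes A: "A \<subseteq> monoid_algebra S" and cl: "v_closure (monoid_algebra S) A = monoid_algebra S"
  obtains u where "to_fract u \<in> A" "coeff u 0 \<noteq> 0"
proof -
  interpret fraction_domain "monoid_algebra S :: 'k poly fract set"
    by (rule fraction_domain_monoid_algebra)
  have "\<exists>u. to_fract u \<in> A \<and> coeff u 0 \<noteq> 0"
  proof (rule ccontr)
    assume no: "\<not> (\<exists>u. to_fract u \<in> A \<and> coeff u 0 \<noteq> 0)"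
    have "to_fract (monom 1 f) \<in> frac_inv (monoid_algebra S) A"
      unfolding frac_inv_iff
    proof
      fix a assume "a \<in> A"
      then obtain p where p: "a = to_fract p" "exponents_in S p" using A monoid_algebraE by blast
      have "coeff p 0 = 0" using no p \<open>a \<in> A\<close> by auto
      then have "n \<in> S" if "coeff (monom 1 f * p) n \<noteq> 0" for n
        using that above_frobenius[of n] by (cases "n \<le> f") (auto simp: coeff_monom_mult split: if_splits)
      then show "to_fract (monom 1 f) * a \<in> monoid_algebra S"
        by (simp add: p exponents_in_def to_fract_mem_monoid_algebra_iff flip: to_fract_mult)
    qed
    moreover have "1 \<in> v_closure (monoid_algebra S) A" using cl one_mem by simp
    ultimately have "to_fract (monom 1 f) \<in> (monoid_algebra S :: 'k poly fract set)"
      unfolding v_closure_def frac_inv_iff[of 1] by simp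
    then show False
      using frobenius_notin by (simp add: to_fract_mem_monoid_algebra_iff exponents_in_def)
  qed
  with that show ?thesis by blast
qed

text \<open>
  Locally at the maximal ideal \<open>M\<close> of polynomials without constant term, an ideal containing a
  polynomial with nonzero constant term is everything; away from \<open>M\<close> the monoid algebra agrees
  with the polynomial ring. So such a \<open>v\<close>-ideal is the contraction of its extension. Instead of
  the extension itself, the proof takes the generator \<open>g\<close> of the possibly larger ideal \<open>N\<close> of the
  polynomials that all elements of the inverse ideal multiply into the polynomial ring.
  Membership of \<open>g\<close> in \<open>N\<close> is what is needed to see that a multiple of \<open>g\<close> in the monoid algebra
  belongs to the \<open>v\<close>-closure of \<open>I\<close>.
\<close>

lemma v_ideal_eq_contraction:
  fixes I :: "'k::field poly fract set"
  assumes cl: "v_closure (monoid_algebra S) I = I" and I: "I \<subseteq> monoid_algebra S"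
    and u: "to_fract u \<in> I" "coeff u 0 \<noteq> 0"
  obtains g where "coeff g 0 \<noteq> 0" "I = contraction S g"
proof -
  interpret fraction_domain "monoid_algebra S :: 'k poly fract set"
    by (rule fraction_domain_monoid_algebra)
  have exp_u: "exponents_in S u" using I u(1) to_fract_mem_monoid_algebra_iff by blast
  define J where "J = frac_inv (monoid_algebra S) I"
  define N where "N = {p :: 'k poly. \<forall>y\<in>J. \<exists>v. y * to_fract p = to_fract v}"
  have I_N: "p \<in> N" if "to_fract p \<in> I" for p
    unfolding N_def
  proof (intro CollectI ballI)
    fix y assume "y \<in> J"
    with that have "y * to_fract p \<in> monoid_algebra S" unfolding J_def frac_inv_iff by blast
    then show "\<exists>v. y * to_fract p = to_fract v" by (metis monoid_algebraE)
  qed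
  have "u \<noteq> 0" using u(2) by auto
  obtain g where g: "g \<in> N" "\<And>p. p \<in> N \<Longrightarrow> g dvd p"
  proof (rule poly_ideal_generator[of u N])
    fix p q assume pq: "p \<in> N" "q \<in> N"
    show "p - q \<in> N"
      unfolding N_def
    proof (intro CollectI ballI)
      fix y assume "y \<in> J"
      with pq obtain v w where "y * to_fract p = to_fract v" "y * to_fract q = to_fract w"
        unfolding N_def by blast
      then have "y * to_fract (p - q) = to_fract (v - w)" by (simp add: right_diff_distrib)
      then show "\<exists>v. y * to_fract (p - q) = to_fract v" ..
    qed
  next
    fix r p assume p: "p \<in> N"
    show "r * p \<in> N"
      unfolding N_def
    proof (intro CollectI ballI)
      fix y assume "y \<in> J"
      with p obtain v where "y * to_fract p = to_fract v" unfolding N_def by blast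
      then have "y * to_fract (r * p) = to_fract (r * v)" by (simp add: mult.left_commute)
      then show "\<exists>v. y * to_fract (r * p) = to_fract v" ..
    qed
  qed (use u I_N \<open>u \<noteq> 0\<close> in auto)
  have "I = contraction S g"
  proof (intro Set.set_eqI iffI)
    fix x assume x: "x \<in> I"
    then obtain p where "x = to_fract p" "exponents_in S p" using I monoid_algebraE by blast
    with x g I_N show "x \<in> contraction S g" by (simp add: to_fract_mem_contraction_iff)
  next
    fix x assume "x \<in> contraction S g"
    then obtain p where p: "x = to_fract p" "g dvd p" "exponents_in S p"
      unfolding contraction_def by blast
    then obtain t where x: "x = to_fract (g * t)" and exp: "exponents_in S (g * t)" by blast
    \<comment> \<open>\<open>x * y\<close> is a polynomial because \<open>g \<in> N\<close>; its product with \<open>u\<close> has exponents in \<open>S\<close>, and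
      \<open>u\<close> can be cancelled.\<close>
    have "x * y \<in> monoid_algebra S" if y: "y \<in> J" for y
    proof -
      obtain v where v: "y * to_fract g = to_fract v" using g(1) y unfolding N_def by blast
      obtain d where d: "y * to_fract u = to_fract d" "exponents_in S d"
      proof -
        have "y * to_fract u \<in> monoid_algebra S" using y u(1) unfolding J_def frac_inv_iff by blast
        then show ?thesis using that monoid_algebraE by metis
      qed
      have "x * y = (y * to_fract g) * to_fract t" by (simp add: x mult.commute mult.left_commute)
      then have xy: "x * y = to_fract (v * t)" by (simp only: v to_fract_mult)
      have "to_fract (v * t * u) = (x * y) * to_fract u" by (simp only: xy to_fract_mult)
      also have "\<dots> = x * (y * to_fract u)" by (rule mult.assoc)
      also have "\<dots> = to_fract (d * (g * t))" unfolding d(1) x by (simp add: mult.commute)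
      finally have "v * t * u = d * (g * t)" by (simp only: to_fract_eq_iff)
      then have "exponents_in S (v * t * u)" using exponents_in_mult[OF d(2) exp] by (simp only:)
      then have "exponents_in S (v * t)" using exponents_in_cancel[OF exp_u u(2)] by blast
      then show ?thesis by (simp only: xy to_fract_mem_monoid_algebra_iff)
    qed
    then have "x \<in> v_closure (monoid_algebra S) I" by (simp add: v_closure_def frac_inv_iff J_def)
    then show "x \<in> I" by (simp add: cl)
  qed
  moreover have "coeff g 0 \<noteq> 0"
  proof -
    obtain t where "u = g * t" using g(2)[OF I_N[OF u(1)]] by (auto simp: dvd_def)
    with u(2) show ?thesis by (auto simp: coeff_mult)
  qed
  ultimately show ?thesis using that by blast
qed

text \<open>
  If \<open>(I J)\<^sub>v = D\<close> and \<open>a * b\<close> with \<open>a \<in> I\<close>, \<open>b \<in> J\<close> has a nonzero constant term, then \<open>b I\<close>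
  contains that element and lies in \<open>D\<close>.
\<close>

lemma v_invertible_multiple_contraction:
  fixes I :: "'k::field poly fract set"
  assumes "v_invertible (monoid_algebra S) I"
  obtains x g where "x \<noteq> 0" "coeff g 0 \<noteq> 0" "x *o I = contraction S g"
proof -
  interpret fraction_domain "monoid_algebra S :: 'k poly fract set"
    by (rule fraction_domain_monoid_algebra)
  from assms obtain J where "v_mult (monoid_algebra S) I J = monoid_algebra S"
    unfolding v_invertible_def by blast
  then have IJ: "v_closure (monoid_algebra S) (I * J) = monoid_algebra S"
    by (simp only: v_mult_def)
  from assms have "fractional_v_ideal (monoid_algebra S) I" unfolding v_invertible_def by blast
  then have cl: "v_closure (monoid_algebra S) I = I" by (simp add: fractional_v_ideal_def)
  have prod_mem: "a * b \<in> monoid_algebra S" if "a \<in> I" "b \<in> J" for a b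
  proof -
    have "a * b \<in> I * J" using that by blast
    then show ?thesis using subset_v_closure[of "I * J"] unfolding IJ by blast
  qed
  then have "I * J \<subseteq> monoid_algebra S" by (auto simp: set_times_def)
  then obtain u where u: "to_fract u \<in> I * J" "coeff u 0 \<noteq> 0"
    using v_closure_eq_imp_nonzero_constant_term IJ by blast
  then obtain a b where ab: "to_fract u = a * b" "a \<in> I" "b \<in> J" by (auto simp: set_times_def)
  have "u \<noteq> 0" using u(2) by auto
  then have "to_fract u \<noteq> 0" by simp
  then have b: "b \<noteq> 0" using ab by auto
  obtain g where "coeff g 0 \<noteq> 0" "b *o I = contraction S g"
  proof (rule v_ideal_eq_contraction)
    show "v_closure (monoid_algebra S) (b *o I) = b *o I" using b cl by (simp add: v_closure_scale)
    show "b *o I \<subseteq> monoid_algebra S"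
      using prod_mem[OF _ ab(3)] by (auto simp: elt_set_times_def mult.commute)
    show "to_fract u \<in> b *o I" using ab by (auto simp: elt_set_times_def mult.commute)
  qed (use u in auto)
  with b that show ?thesis by blast
qed

section \<open>Contractions of prime ideals\<close>

text \<open>
  For every \<open>t\<close> the products \<open>p * t\<close> and \<open>g * t\<close> agree in all exponents up to \<open>f\<close>, and beyond \<open>f\<close>
  every exponent is in \<open>S\<close>.
\<close>

lemma contraction_scale:
  fixes p g :: "'k::field poly"
  assumes eq: "\<And>i. i \<le> f \<Longrightarrow> coeff p i = coeff g i" and "g \<noteq> 0" "p \<noteq> 0"
  shows "(to_fract p / to_fract g) *o contraction S g = contraction S p"
proof -
  have "exponents_in S (g * t) \<longleftrightarrow> exponents_in S (p * t)" for t
  proof -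
    have "coeff (p * t) n = coeff (g * t) n" if "n \<le> f" for n
      using that eq by (auto simp: coeff_mult intro!: sum.cong)
    then have "coeff (p * t) n = coeff (g * t) n \<or> n \<in> S" for n
      using above_frobenius not_le by blast
    then show ?thesis unfolding exponents_in_def by metis
  qed
  moreover have "contraction S q = (\<lambda>t. to_fract q * to_fract t) ` {t. exponents_in S (q * t)}"
    for q :: "'k poly"
    unfolding contraction_def dvd_def by (force simp: image_iff)
  ultimately have
    "contraction S g = (\<lambda>t. to_fract g * to_fract t) ` {t. exponents_in S (p * t)}"
    "contraction S p = (\<lambda>t. to_fract p * to_fract t) ` {t. exponents_in S (p * t)}"
    by simp_all
  moreover have "x *o A = (*) x ` A" for x :: "'k poly fract" and A
    by (auto simp: elt_set_times_def)
  ultimately show ?thesis using assms(2) by (simp add: image_image)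
qed

text \<open>
  The contraction of \<open>(p)\<close> contains \<open>X\<^sup>f\<^sup>+\<^sup>1 * p\<close> and so determines \<open>p\<close> up to a constant factor;
  the constant term fixes that factor.
\<close>

lemma contraction_inject:
  fixes p q :: "'k::field poly"
  assumes eq: "contraction S p = contraction S q"
    and p: "irreducible p" and q: "irreducible q"
    and const: "coeff p 0 = coeff q 0" "coeff p 0 \<noteq> 0"
  shows "p = q"
proof -
  have "to_fract (monom 1 (Suc f) * p) \<in> contraction S p"
    unfolding to_fract_mem_contraction_iff using exponents_in_conductor dvd_triv_right by blast
  then have dvd: "q dvd monom 1 (Suc f) * p" unfolding eq to_fract_mem_contraction_iff by blast
  have "coeff q 0 \<noteq> 0" using const by metis
  from irreducible_dvd_monom_multiple[OF q this dvd] obtain c where c: "p = q * c"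
    by (rule dvdE)
  have "c dvd 1" using irreducibleD[OF p c] irreducible_not_unit[OF q] by blast
  then obtain k where k: "c = [:k:]" unfolding is_unit_poly_iff by blast
  have "coeff p 0 = coeff q 0 * k" unfolding c k by (simp add: coeff_mult)
  then have "k = 1" using \<open>coeff q 0 \<noteq> 0\<close> unfolding const(1) by simp
  then show ?thesis using c k by simp
qed

lemma primeideal_contraction:
  fixes p :: "'k::field poly"
  assumes p: "irreducible p"
  shows "primeideal (contraction S p) (domain_ring (monoid_algebra S))"
proof -
  interpret fraction_domain "monoid_algebra S :: 'k poly fract set"
    by (rule fraction_domain_monoid_algebra)
  note mem = to_fract_mem_contraction_iff
  have prime: "prime_elem p" using p by (rule field_poly_irreducible_imp_prime)
  show ?thesis
  proof (rule primeideal_domain_ringI)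
    show "contraction S p \<subseteq> monoid_algebra S" by (rule contraction_subset)
    show "0 \<in> contraction S p" using mem[of 0 S p] by (simp add: exponents_in_def)
    show "1 \<notin> contraction S p" using mem[of 1 S p] p irreducible_not_unit by auto
  next
    fix x y :: "'k poly fract" assume "x \<in> contraction S p" "y \<in> contraction S p"
    then obtain a b where "x = to_fract a" "p dvd a" "exponents_in S a"
      "y = to_fract b" "p dvd b" "exponents_in S b"
      unfolding contraction_def by blast
    then show "x - y \<in> contraction S p"
      using mem[of "a - b" S p] by (simp add: exponents_in_diff)
  next
    fix x y :: "'k poly fract" assume x: "x \<in> monoid_algebra S" and y: "y \<in> contraction S p"
    from x obtain a where "x = to_fract a" "exponents_in S a" by (rule monoid_algebraE)
    moreover from y obtain b where "y = to_fract b" "p dvd b" "exponents_in S b"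
      unfolding contraction_def by blast
    ultimately show "x * y \<in> contraction S p"
      using mem[of "a * b" S p] by (simp add: exponents_in_mult)
  next
    fix x y :: "'k poly fract"
    assume x: "x \<in> monoid_algebra S" and y: "y \<in> monoid_algebra S"
      and xy: "x * y \<in> contraction S p"
    from x obtain a where a: "x = to_fract a" "exponents_in S a" by (rule monoid_algebraE)
    from y obtain b where b: "y = to_fract b" "exponents_in S b" by (rule monoid_algebraE)
    have "p dvd a * b" using xy mem[of "a * b" S p] by (simp add: a b)
    then have "p dvd a \<or> p dvd b" using prime prime_elem_dvd_multD by blast
    then show "x \<in> contraction S p \<or> y \<in> contraction S p" using a b by (simp add: mem)
  qed
qed

text \<open>
  Let \<open>Q\<close> be a nonzero prime inside the contraction \<open>P\<close> of \<open>(p)\<close>, and \<open>e = X\<^sup>f\<^sup>+\<^sup>1\<close>, which moves all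
  polynomials into the monoid algebra and is not in \<open>P\<close>. If \<open>e * q \<in> Q\<close>, then \<open>q = p * h\<close> for
  some \<open>h\<close>, and \<open>e * (e * q) = (e * p) * (e * h)\<close> shows that \<open>Q\<close> contains \<open>e * p\<close> or \<open>e * h\<close>. As
  \<open>h\<close> has lower degree than \<open>q\<close>, repeating this leads to \<open>e * p \<in> Q\<close>. Then \<open>Q\<close> contains
  \<open>e\<^sup>2 * p * t\<close> for all \<open>t\<close>, hence every \<open>p * t\<close> in \<open>P\<close>.
\<close>

lemma prime_height_contraction:
  fixes p :: "'k::field poly"
  assumes p: "irreducible p" "coeff p 0 \<noteq> 0"
  shows "prime_height (domain_ring (monoid_algebra S)) (contraction S p) = 1"
proof -
  interpret fraction_domain "monoid_algebra S :: 'k poly fract set"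
    by (rule fraction_domain_monoid_algebra)
  define e :: "'k poly" where "e = monom 1 (Suc f)"
  have e_mem: "to_fract (e * t) \<in> monoid_algebra S" for t
    unfolding e_def to_fract_mem_monoid_algebra_iff by (rule exponents_in_conductor)
  have e_dvd: "p dvd t" if "p dvd e * t" for t
    using irreducible_dvd_monom_multiple[OF p] that unfolding e_def .
  have "e \<noteq> 0" "p \<noteq> 0" using p by (auto simp: e_def)
  show ?thesis
  proof (rule prime_height_eq_1)
    show "primeideal (contraction S p) (domain_ring (monoid_algebra S))"
      using p(1) by (rule primeideal_contraction)
    have "to_fract (e * p) \<in> contraction S p"
      using e_mem[of p] by (simp only: to_fract_mem_contraction_iff to_fract_mem_monoid_algebra_iff) simp
    moreover have "to_fract (e * p) \<noteq> 0" using \<open>e \<noteq> 0\<close> \<open>p \<noteq> 0\<close> by simp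
    ultimately show "contraction S p \<noteq> {0}" by blast
  next
    fix Q :: "'k poly fract set"
    assume Q: "primeideal Q (domain_ring (monoid_algebra S))" and sub: "Q \<subseteq> contraction S p"
      and "Q \<noteq> {0}"
    note QD = primeideal_domain_ringD[OF Q]
    have ep: "to_fract (e * p) \<in> Q" if "q \<noteq> 0" "to_fract (e * q) \<in> Q" for q
      using that
    proof (induction "degree q" arbitrary: q rule: less_induct)
      case less
      have "to_fract (e * q) \<in> contraction S p" using sub less.prems(2) by blast
      then have "p dvd e * q" unfolding to_fract_mem_contraction_iff by blast
      then obtain h where h: "q = p * h" using e_dvd by (auto simp: dvd_def)
      have "degree p \<noteq> 0" using p(1) \<open>p \<noteq> 0\<close> irreducible_not_unit is_unit_iff_degree by blast
      then have deg: "degree h < degree q" and "h \<noteq> 0"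
        using h less.prems(1) by (auto simp: degree_mult_eq)
      \<comment> \<open>The element \<open>e\<close> is written as \<open>e * 1\<close> to match \<open>e_mem\<close>.\<close>
      have "to_fract (e * 1) * to_fract (e * q) \<in> Q" using QD(3) e_mem less.prems(2) by blast
      also have "to_fract (e * 1) * to_fract (e * q) = to_fract (e * p) * to_fract (e * h)"
        by (simp add: h ac_simps)
      finally have "to_fract (e * p) \<in> Q \<or> to_fract (e * h) \<in> Q" using QD(4) e_mem by blast
      then show ?case using less.hyps[OF deg \<open>h \<noteq> 0\<close>] by blast
    qed
    obtain x where x: "x \<in> Q" "x \<noteq> 0" using \<open>Q \<noteq> {0}\<close> QD(2) by blast
    then obtain q where q: "x = to_fract q" using QD(1) monoid_algebraE by blast
    have "to_fract (e * 1) * x \<in> Q" using QD(3) e_mem x by blast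
    then have epQ: "to_fract (e * p) \<in> Q" using ep[of q] x q by simp
    have e_notin: "to_fract (e * 1) \<notin> Q"
    proof
      assume "to_fract (e * 1) \<in> Q"
      then have "to_fract (e * 1) \<in> contraction S p" using sub by blast
      then have "p dvd e * 1" unfolding to_fract_mem_contraction_iff by blast
      then show False using e_dvd irreducible_not_unit[OF p(1)] by blast
    qed
    have "contraction S p \<subseteq> Q"
    proof
      fix y assume "y \<in> contraction S p"
      then have y_mem: "y \<in> monoid_algebra S" using contraction_subset by blast
      obtain r where "y = to_fract r" "p dvd r"
        using \<open>y \<in> contraction S p\<close> unfolding contraction_def by blast
      then obtain t where y: "y = to_fract (p * t)" by blast
      have "to_fract (e * t) * to_fract (e * p) \<in> Q" using QD(3) e_mem epQ by blast
      also have "to_fract (e * t) * to_fract (e * p) = to_fract (e * 1) * (to_fract (e * 1) * y)"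
        by (simp add: y ac_simps)
      finally show "y \<in> Q" using QD(4) e_mem e_notin mult_mem y_mem by blast
    qed
    with sub show "Q = contraction S p" by blast
  qed
qed

section \<open>Prime divisors in a given class\<close>

text \<open>
  The class determines a polynomial \<open>g\<close> whose first coefficients are the ones to prescribe for an
  irreducible polynomial.
\<close>

lemma v_class_contains_contractions:
  fixes C :: "'k::field poly fract set set"
  assumes C: "C \<in> carrier (v_class_group (monoid_algebra S))"
  obtains g where "coeff g 0 \<noteq> 0"
    and "\<forall>p. irreducible p \<and> (\<forall>i\<le>f. coeff p i = coeff g i) \<longrightarrow>
      contraction S p \<in> C \<and> prime_divisor (monoid_algebra S) (contraction S p)"
proof -
  interpret fraction_domain "monoid_algebra S :: 'k poly fract set"
    by (rule fraction_domain_monoid_algebra)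
  obtain I where I: "v_invertible (monoid_algebra S) I" and C_eq: "C = {x *o I |x. x \<noteq> 0}"
    using v_class_eq_multiples[OF C] .
  obtain b g where b: "b \<noteq> 0" and g: "coeff g 0 \<noteq> 0" and bI: "b *o I = contraction S g"
    using v_invertible_multiple_contraction[OF I] .
  have "contraction S p \<in> C \<and> prime_divisor (monoid_algebra S) (contraction S p)"
    if p: "irreducible p" and eq: "\<And>i. i \<le> f \<Longrightarrow> coeff p i = coeff g i" for p
  proof -
    have "g \<noteq> 0" "p \<noteq> 0" using g p by auto
    then have "contraction S p = (to_fract p / to_fract g) *o (b *o I)"
      unfolding bI using contraction_scale[OF eq] by simp
    then have P: "contraction S p = (to_fract p / to_fract g * b) *o I"
      by (simp add: set_times_rearrange2)
    have nz: "to_fract p / to_fract g * b \<noteq> 0" using b \<open>g \<noteq> 0\<close> \<open>p \<noteq> 0\<close> by simp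
    have "v_invertible (monoid_algebra S) (contraction S p)"
      unfolding P using nz I by (rule v_invertible_scale)
    moreover from this have "v_ideal (monoid_algebra S) (contraction S p)"
      using contraction_subset by (auto simp: v_ideal_def v_invertible_def)
    moreover have "coeff p 0 \<noteq> 0" using g eq[of 0] by simp
    ultimately have "prime_divisor (monoid_algebra S) (contraction S p)"
      using primeideal_contraction[OF p] prime_height_contraction[OF p]
      by (simp add: prime_divisor_def)
    then show ?thesis using nz P C_eq by blast
  qed
  with g that show ?thesis by blast
qed

end

theorem theorem1:
  fixes S :: "nat set"
  assumes "numerical_monoid S" and "S \<noteq> UNIV"
  shows
    "((\<forall>a::nat \<Rightarrow> 'k::field. a 0 \<noteq> 0 \<longrightarrow>
         (\<exists>p::'k poly. irreducible p \<and> (\<forall>i\<le>frobenius_number S. coeff p i = a i)))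
       \<longrightarrow> (\<forall>C\<in>carrier (v_class_group (monoid_algebra S :: 'k poly fract set)).
             \<exists>P\<in>C. prime_divisor (monoid_algebra S) P))
     \<and>
     ((\<forall>a::nat \<Rightarrow> 'k. a 0 \<noteq> 0 \<longrightarrow>
         infinite {p::'k poly. irreducible p \<and> (\<forall>i\<le>frobenius_number S. coeff p i = a i)})
       \<longrightarrow> (\<forall>C\<in>carrier (v_class_group (monoid_algebra S :: 'k poly fract set)).
             infinite {P \<in> C. prime_divisor (monoid_algebra S) P}))"
proof -
  interpret proper_numerical_monoid S using assms by unfold_locales
  show ?thesis
  proof (intro conjI impI ballI)
    fix C :: "'k poly fract set set"
    assume ex: "\<forall>a::nat \<Rightarrow> 'k. a 0 \<noteq> 0 \<longrightarrow> (\<exists>p. irreducible p \<and> (\<forall>i\<le>f. coeff p i = a i))"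
      and C: "C \<in> carrier (v_class_group (monoid_algebra S))"
    obtain g where "coeff g 0 \<noteq> 0"
      and g: "\<forall>p. irreducible p \<and> (\<forall>i\<le>f. coeff p i = coeff g i) \<longrightarrow>
        contraction S p \<in> C \<and> prime_divisor (monoid_algebra S) (contraction S p)"
      using v_class_contains_contractions[OF C] by blast
    then obtain p where "irreducible p" "\<forall>i\<le>f. coeff p i = coeff g i" using ex by meson
    with g show "\<exists>P\<in>C. prime_divisor (monoid_algebra S) P" by blast
  next
    fix C :: "'k poly fract set set"
    assume inf: "\<forall>a::nat \<Rightarrow> 'k. a 0 \<noteq> 0 \<longrightarrow>
        infinite {p. irreducible p \<and> (\<forall>i\<le>f. coeff p i = a i)}"
      and C: "C \<in> carrier (v_class_group (monoid_algebra S))"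
    obtain g where g0: "coeff g 0 \<noteq> 0"
      and g: "\<forall>p. irreducible p \<and> (\<forall>i\<le>f. coeff p i = coeff g i) \<longrightarrow>
        contraction S p \<in> C \<and> prime_divisor (monoid_algebra S) (contraction S p)"
      using v_class_contains_contractions[OF C] by blast
    let ?A = "{p. irreducible p \<and> (\<forall>i\<le>f. coeff p i = coeff g i)}"
    have "inj_on (contraction S) ?A"
      by (rule inj_onI, rule contraction_inject) (use g0 in auto)
    moreover have "infinite ?A" using inf g0 by blast
    ultimately have "infinite (contraction S ` ?A)" by (simp add: finite_image_iff)
    moreover have "contraction S ` ?A \<subseteq> {P \<in> C. prime_divisor (monoid_algebra S) P}"
      using g by auto
    ultimately show "infinite {P \<in> C. prime_divisor (monoid_algebra S) P}"
      using infinite_super by blast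
  qed
qed

end
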